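(* SocChain satisfies the validity property: in every execution of SocChain with $n$ blockchain nodes of which at most $t<n/3$ are byzantine, each block appended to the blockchain of each correct blockchain node is a set of valid transactions (non-conflicting well-formed transactions that are correctly signed by their issuer).
   Context: Model. There are $n$ blockchain nodes, of which at most $t<n/3$ are byzantine (behave arbitrarily); the others are correct. Communication is by message passing and is partially synchronous (message delays are bounded by an unknown bound). The adversary is computationally bounded; signatures are unforgeable and verifiable. All nodes share the same genesis block $B_0$ and the same initial state $S$. The predicate $\mathrm{isvalid}(tx)$, evaluated in the node's current state, checks that the transaction $tx$ is well-formed, correctly signed by its issuer, and has a correct nonce (so that it does not conflict with transactions already executed in that state). The transactions of a block $B_\ell$ are the elements of its component $\mathit{val}_k$ below. Consensus. The nodes run consensus instances $i=1,2,\dots$. In instance $i$, each node reliably broadcasts a proposal (a list of transactions $\mathit{txs}$ with a timestamp), and the proposal delivered from node $k$ is stored as $\mathit{props}[k]$, $k\in\{0,\dots,n-1\}$. For each $k$ the nodes run a binary byzantine consensus whose decision is stored as $\mathit{bitmask}[k]\in\{0,1\}$. When $\mathit{bitmask}$ is full and $\mathit{props}[k]$ has been delivered for all $k$ with $\mathit{bitmask}[k]=1$, the node decides the superblock, which is the sequence, ordered by $k$, of the proposals $\mathit{props}[k]$ with $\mathit{bitmask}[k]=1$. Execution. A correct node executes the superblocks decided in instances $1,2,\dots$ in this order, starting with block index $\ell=1$. To execute a superblock, it treats each of its proposals $\mathit{props}[k]$ in increasing order of $k$ (iteration $k$): for every transaction $tx$ in $\mathit{props}[k].\mathit{txs}$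 in order, if $\mathrm{isvalid}(tx)$ holds in the current state, then $tx$ is run by a deterministic function on the current state, giving an updated state and a receipt; the receipt is added to $\mathit{receipts}_k$ and $tx$ to $\mathit{val}_k$; invalid transactions are discarded. $S_{next_k}$ denotes the resulting state. Then $\mathit{timestamp}_k$ is set to the timestamp of $\mathit{props}[k]$, $TX_k$ to the transaction trie updated with $\mathit{val}_k$, and $R_k$ to the receipt trie updated with $\mathit{receipts}_k$. The block $$B_\ell=\langle h(\mathrm{header}(B_{\ell-1})),h(S_{next_k}),h(TX_k),h(R_k),GU_k,GL,\mathit{nonce},\mathit{timestamp}_k,\mathit{val}_k\rangle$$ is created, where $h$ is a hash function, $GU_k$ is the gas used by the executed transactions, and $GL$ (gas limit) and $\mathit{nonce}$ are common to all nodes. The block $B_\ell$ is appended to the local chain and $\ell$ is incremented. Blocks (other than $B_0$) are appended in no other way. *)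

theory Defs
  imports Complex_Main
begin

section \<open>Transactions, proposals and blocks\<close>

text \<open>
  \<open>'acc\<close> is the type of transaction issuers, \<open>'d\<close> the rest of the content of a transaction and
  \<open>'sig\<close> the signatures.  Nothing restricts the values of these records, so byzantine nodes may
  propose malformed, unsigned or conflicting transactions.
\<close>

record ('acc, 'd, 'sig) transaction =
  issuer :: 'acc
  tx_nonce :: nat
  tx_data :: 'd
  signature :: 'sig

text \<open>The content covered by the signature.\<close>
definition signed_content :: "('acc, 'd, 'sig) transaction \<Rightarrow> nat \<times> 'd" where
  "signed_content tx = (tx_nonce tx, tx_data tx)"

text \<open>
  A nonce can be used only once by an issuer.  The relation is meant for two \<^emph>\<open>occurrences\<close> of
  transactions: two occurrences of the same transaction conflict (replay).
\<close>
definition conflicting :: "('acc, 'd, 'sig) transaction \<Rightarrow> ('acc, 'd, 'sig) transaction \<Rightarrow> bool" where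
  "conflicting tx tx' \<longleftrightarrow> issuer tx = issuer tx' \<and> tx_nonce tx = tx_nonce tx'"

record ('acc, 'd, 'sig) proposal =
  txs :: "('acc, 'd, 'sig) transaction list"
  prop_timestamp :: nat

record 'h header =
  parent_hash :: 'h
  state_hash :: 'h
  tx_trie_hash :: 'h
  receipt_trie_hash :: 'h
  gas_used :: nat
  hd_gas_limit :: nat
  hd_nonce :: nat
  hd_timestamp :: nat

record ('acc, 'd, 'sig, 'h) block =
  header :: "'h header"
  val :: "('acc, 'd, 'sig) transaction list"

text \<open>The disjoint union of the kinds of objects to which the (single) hash function is applied.\<close>
datatype ('st, 'tt, 'rt, 'h) hashable =
    Hash_header "'h header"
  | Hash_state 'st
  | Hash_tx_trie 'tt
  | Hash_receipt_trie 'rt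


section \<open>Events and protocol parameters\<close>

text \<open>
  Events are located at a node.  In \<open>Send q m\<close> the node \<open>q\<close> is the destination, in
  \<open>Receive q m\<close> it is the sender.  In the events of reliable broadcast (\<open>Rb\<close>) and binary
  consensus (\<open>Bin\<close>), \<open>i\<close> is the consensus instance and \<open>k\<close> the index of the proposer.
\<close>
datatype ('acc, 'd, 'sig, 'm) event =
    Idle
  | Send nat 'm
  | Receive nat 'm
  | Rb_broadcast nat "('acc, 'd, 'sig) proposal"
  | Rb_deliver nat nat "('acc, 'd, 'sig) proposal"
  | Bin_propose nat nat bool
  | Bin_decide nat nat bool
  | Decide_superblock nat
  | Start_superblock
  | Execute_proposal

text \<open>
  \<open>verify a c g\<close> is the check that \<open>g\<close> is a signature of the content \<open>c\<close> under the public key of \<open>a\<close>.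
  The field \<open>comm\<close> is the message-passing implementation of reliable broadcast and of binary
  consensus: \<open>comm p hist (\<tau>, e)\<close> says that node \<open>p\<close>, whose timed local history (including
  the messages it received) is \<open>hist\<close>, may perform the event \<open>e\<close> at time \<open>\<tau>\<close>.
\<close>
record ('acc, 'd, 'sig, 'st, 'rc, 'tt, 'rt, 'h, 'm) socchain =
  well_formed :: "('acc, 'd, 'sig) transaction \<Rightarrow> bool"
  verify :: "'acc \<Rightarrow> nat \<times> 'd \<Rightarrow> 'sig \<Rightarrow> bool"
  account_nonce :: "'st \<Rightarrow> 'acc \<Rightarrow> nat"
  run :: "'st \<Rightarrow> ('acc, 'd, 'sig) transaction \<Rightarrow> 'st \<times> 'rc"
  gas :: "'rc \<Rightarrow> nat"
  update_tx_trie :: "'tt \<Rightarrow> ('acc, 'd, 'sig) transaction list \<Rightarrow> 'tt"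
  update_receipt_trie :: "'rt \<Rightarrow> 'rc list \<Rightarrow> 'rt"
  hash :: "('st, 'tt, 'rt, 'h) hashable \<Rightarrow> 'h"
  gas_limit :: nat
  block_nonce :: nat
  genesis :: "('acc, 'd, 'sig, 'h) block"
  init_state :: 'st
  init_tx_trie :: 'tt
  init_receipt_trie :: 'rt
  comm :: "nat \<Rightarrow> (real \<times> ('acc, 'd, 'sig, 'm) event) list
             \<Rightarrow> real \<times> ('acc, 'd, 'sig, 'm) event \<Rightarrow> bool"

definition correct_nonce ::
    "('acc, 'd, 'sig, 'st, 'rc, 'tt, 'rt, 'h, 'm) socchain \<Rightarrow> 'st
       \<Rightarrow> ('acc, 'd, 'sig) transaction \<Rightarrow> bool" where
  "correct_nonce P s tx \<longleftrightarrow> tx_nonce tx = account_nonce P s (issuer tx)"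

definition isvalid ::
    "('acc, 'd, 'sig, 'st, 'rc, 'tt, 'rt, 'h, 'm) socchain \<Rightarrow> 'st
       \<Rightarrow> ('acc, 'd, 'sig) transaction \<Rightarrow> bool" where
  "isvalid P s tx \<longleftrightarrow>
     well_formed P tx \<and>
     verify P (issuer tx) (signed_content tx) (signature tx) \<and>
     correct_nonce P s tx"

text \<open>
  The semantics of account nonces: running a transaction consumes the nonce of its issuer and
  never gives back a nonce already consumed.  This is what makes the nonce check of \<open>isvalid\<close>
  meaningful; apart from it, \<open>run\<close> is an arbitrary function.
\<close>
definition nonces_consumed ::
    "('acc, 'd, 'sig, 'st, 'rc, 'tt, 'rt, 'h, 'm) socchain \<Rightarrow> bool" where
  "nonces_consumed P \<longleftrightarrow>
     (\<forall>s tx. isvalid P s tx \<longrightarrow>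
        account_nonce P s (issuer tx) < account_nonce P (fst (run P s tx)) (issuer tx) \<and>
        (\<forall>a. account_nonce P s a \<le> account_nonce P (fst (run P s tx)) a))"


section \<open>Behaviour of a correct node\<close>

text \<open>
  \<open>chain\<close> starts with the genesis block, so that \<open>chain ! l\<close> is the block of index \<open>l\<close>.
  \<open>pending\<close> contains the proposals still to be treated in the superblock being executed, and
  \<open>next_instance\<close> is the instance of the superblock to be executed after it.
\<close>
record ('acc, 'd, 'sig, 'st, 'tt, 'rt, 'h) node_state =
  props :: "nat \<Rightarrow> nat \<Rightarrow> ('acc, 'd, 'sig) proposal option"
  bitmask :: "nat \<Rightarrow> nat \<Rightarrow> bool option"
  superblocks :: "nat \<Rightarrow> ('acc, 'd, 'sig) proposal list option"
  next_instance :: nat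
  pending :: "('acc, 'd, 'sig) proposal list"
  state :: 'st
  tx_trie :: 'tt
  receipt_trie :: 'rt
  block_index :: nat
  chain :: "('acc, 'd, 'sig, 'h) block list"

definition init_node ::
    "('acc, 'd, 'sig, 'st, 'rc, 'tt, 'rt, 'h, 'm) socchain
       \<Rightarrow> ('acc, 'd, 'sig, 'st, 'tt, 'rt, 'h) node_state" where
  "init_node P =
     \<lparr>props = (\<lambda>_ _. None), bitmask = (\<lambda>_ _. None), superblocks = (\<lambda>_. None),
      next_instance = 1, pending = [], state = init_state P,
      tx_trie = init_tx_trie P, receipt_trie = init_receipt_trie P,
      block_index = 1, chain = [genesis P]\<rparr>"

definition superblock_ready ::
    "nat \<Rightarrow> ('acc, 'd, 'sig, 'st, 'tt, 'rt, 'h) node_state \<Rightarrow> nat \<Rightarrow> bool" where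
  "superblock_ready n \<sigma> i \<longleftrightarrow>
     (\<forall>k<n. bitmask \<sigma> i k \<noteq> None) \<and>
     (\<forall>k<n. bitmask \<sigma> i k = Some True \<longrightarrow> props \<sigma> i k \<noteq> None)"

definition superblock ::
    "nat \<Rightarrow> ('acc, 'd, 'sig, 'st, 'tt, 'rt, 'h) node_state \<Rightarrow> nat
       \<Rightarrow> ('acc, 'd, 'sig) proposal list" where
  "superblock n \<sigma> i =
     map (\<lambda>k. the (props \<sigma> i k)) (filter (\<lambda>k. bitmask \<sigma> i k = Some True) [0..<n])"

text \<open>The resulting state, the receipts and the executed transactions.\<close>
fun execute_txs ::
    "('acc, 'd, 'sig, 'st, 'rc, 'tt, 'rt, 'h, 'm) socchain \<Rightarrow> 'st
       \<Rightarrow> ('acc, 'd, 'sig) transaction list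
       \<Rightarrow> 'st \<times> 'rc list \<times> ('acc, 'd, 'sig) transaction list" where
  "execute_txs P s [] = (s, [], [])"
| "execute_txs P s (tx # rest) =
     (if isvalid P s tx then
        (let (s', r) = run P s tx;
             (s'', rs, vs) = execute_txs P s' rest
         in (s'', r # rs, tx # vs))
      else execute_txs P s rest)"

definition execute_proposal ::
    "('acc, 'd, 'sig, 'st, 'rc, 'tt, 'rt, 'h, 'm) socchain \<Rightarrow> ('acc, 'd, 'sig) proposal
       \<Rightarrow> ('acc, 'd, 'sig, 'st, 'tt, 'rt, 'h) node_state
       \<Rightarrow> ('acc, 'd, 'sig, 'st, 'tt, 'rt, 'h) node_state" where
  "execute_proposal P pr \<sigma> =
     (let (s', receipts, vs) = execute_txs P (state \<sigma>) (txs pr);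
          TX = update_tx_trie P (tx_trie \<sigma>) vs;
          R = update_receipt_trie P (receipt_trie \<sigma>) receipts;
          B = \<lparr>header =
                 \<lparr>parent_hash = hash P (Hash_header (header (chain \<sigma> ! (block_index \<sigma> - 1)))),
                  state_hash = hash P (Hash_state s'),
                  tx_trie_hash = hash P (Hash_tx_trie TX),
                  receipt_trie_hash = hash P (Hash_receipt_trie R),
                  gas_used = sum_list (map (gas P) receipts),
                  hd_gas_limit = gas_limit P,
                  hd_nonce = block_nonce P,
                  hd_timestamp = prop_timestamp pr\<rparr>,
               val = vs\<rparr>
      in \<sigma>\<lparr>state := s', tx_trie := TX, receipt_trie := R,
           chain := chain \<sigma> @ [B], block_index := block_index \<sigma> + 1\<rparr>)"

text \<open>Effect of an event of a correct node on its variables (\<open>n\<close> is the number of nodes).\<close>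
fun node_step ::
    "('acc, 'd, 'sig, 'st, 'rc, 'tt, 'rt, 'h, 'm) socchain \<Rightarrow> nat
       \<Rightarrow> ('acc, 'd, 'sig, 'st, 'tt, 'rt, 'h) node_state
       \<Rightarrow> ('acc, 'd, 'sig, 'm) event
       \<Rightarrow> ('acc, 'd, 'sig, 'st, 'tt, 'rt, 'h) node_state \<Rightarrow> bool" where
  "node_step P n \<sigma> (Rb_deliver i k pr) \<sigma>' \<longleftrightarrow>
     1 \<le> i \<and> k < n \<and>
     \<sigma>' = \<sigma>\<lparr>props := (props \<sigma>)(i := (props \<sigma> i)(k := Some pr))\<rparr>"
| "node_step P n \<sigma> (Bin_decide i k b) \<sigma>' \<longleftrightarrow>
     1 \<le> i \<and> k < n \<and>
     \<sigma>' = \<sigma>\<lparr>bitmask := (bitmask \<sigma>)(i := (bitmask \<sigma> i)(k := Some b))\<rparr>"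
| "node_step P n \<sigma> (Decide_superblock i) \<sigma>' \<longleftrightarrow>
     1 \<le> i \<and> superblocks \<sigma> i = None \<and> superblock_ready n \<sigma> i \<and>
     \<sigma>' = \<sigma>\<lparr>superblocks := (superblocks \<sigma>)(i := Some (superblock n \<sigma> i))\<rparr>"
| "node_step P n \<sigma> Start_superblock \<sigma>' \<longleftrightarrow>
     pending \<sigma> = [] \<and>
     (\<exists>sb. superblocks \<sigma> (next_instance \<sigma>) = Some sb \<and>
           \<sigma>' = \<sigma>\<lparr>pending := sb, next_instance := next_instance \<sigma> + 1\<rparr>)"
| "node_step P n \<sigma> Execute_proposal \<sigma>' \<longleftrightarrow>
     (\<exists>pr rest. pending \<sigma> = pr # rest \<and>
                \<sigma>' = (execute_proposal P pr \<sigma>)\<lparr>pending := rest\<rparr>)"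
| "node_step P n \<sigma> _ \<sigma>' \<longleftrightarrow> \<sigma>' = \<sigma>"


section \<open>Executions\<close>

text \<open>
  An execution is an infinite sequence of timed events, \<open>Idle\<close> events serving as padding.
  \<open>event_at E s = (p, e)\<close> means that the step number \<open>s\<close> is the event \<open>e\<close> of node \<open>p\<close>;
  \<open>node E s p\<close> holds the variables of \<open>p\<close> before that step.  \<open>produced_sigs\<close> contains
  \<open>(a, c, g)\<close> if the account holder \<open>a\<close> actually produced the signature \<open>g\<close> of the content \<open>c\<close>.
\<close>
record ('acc, 'd, 'sig, 'st, 'tt, 'rt, 'h, 'm) execution =
  byzantine :: "nat set"
  event_at :: "nat \<Rightarrow> nat \<times> ('acc, 'd, 'sig, 'm) event"
  time :: "nat \<Rightarrow> real"
  node :: "nat \<Rightarrow> nat \<Rightarrow> ('acc, 'd, 'sig, 'st, 'tt, 'rt, 'h) node_state"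
  produced_sigs :: "('acc \<times> (nat \<times> 'd) \<times> 'sig) set"

definition correct :: "nat \<Rightarrow> ('acc, 'd, 'sig, 'st, 'tt, 'rt, 'h, 'm) execution \<Rightarrow> nat set" where
  "correct n E = {..<n} - byzantine E"

definition local_history ::
    "('acc, 'd, 'sig, 'st, 'tt, 'rt, 'h, 'm) execution \<Rightarrow> nat \<Rightarrow> nat
       \<Rightarrow> (real \<times> ('acc, 'd, 'sig, 'm) event) list" where
  "local_history E p s =
     map (\<lambda>j. (time E j, snd (event_at E j))) (filter (\<lambda>j. fst (event_at E j) = p) [0..<s])"

fun communication_event :: "('acc, 'd, 'sig, 'm) event \<Rightarrow> bool" where
  "communication_event (Send _ _) = True"
| "communication_event (Rb_deliver _ _ _) = True"
| "communication_event (Bin_propose _ _ _) = True"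
| "communication_event (Bin_decide _ _ _) = True"
| "communication_event _ = False"

text \<open>Byzantine nodes are subject to no condition here.\<close>
definition correct_nodes_follow_protocol ::
    "('acc, 'd, 'sig, 'st, 'rc, 'tt, 'rt, 'h, 'm) socchain \<Rightarrow> nat
       \<Rightarrow> ('acc, 'd, 'sig, 'st, 'tt, 'rt, 'h, 'm) execution \<Rightarrow> bool" where
  "correct_nodes_follow_protocol P n E \<longleftrightarrow>
     (\<forall>p\<in>correct n E.
        node E 0 p = init_node P \<and>
        (\<forall>s. if fst (event_at E s) = p
             then node_step P n (node E s p) (snd (event_at E s)) (node E (Suc s) p)
             else node E (Suc s) p = node E s p) \<and>
        (\<forall>s e. event_at E s = (p, e) \<and> communication_event e \<longrightarrow>
               comm P p (local_history E p s) (time E s, e)) \<and>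
        (\<forall>s s' i pr pr'. event_at E s = (p, Rb_broadcast i pr) \<and>
               event_at E s' = (p, Rb_broadcast i pr') \<longrightarrow> s = s'))"

definition progressing_time :: "('acc, 'd, 'sig, 'st, 'tt, 'rt, 'h, 'm) execution \<Rightarrow> bool" where
  "progressing_time E \<longleftrightarrow> mono (time E) \<and> (\<forall>r. \<exists>s. r < time E s)"

text \<open>
  Message passing with partial synchrony.  The function \<open>src\<close> maps the reception of a message to
  the step that sent it, so messages are neither invented, altered, duplicated nor lost and
  their senders are authentic.  The bound \<open>\<Delta>\<close> depends on the execution and is unknown to the
  protocol.
\<close>
definition partially_synchronous ::
    "nat \<Rightarrow> ('acc, 'd, 'sig, 'st, 'tt, 'rt, 'h, 'm) execution \<Rightarrow> bool" where
  "partially_synchronous n E \<longleftrightarrow>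
     (\<exists>src :: nat \<Rightarrow> nat.
        (\<forall>s p q m. q \<in> correct n E \<and> event_at E s = (q, Receive p m) \<longrightarrow>
             src s < s \<and> event_at E (src s) = (p, Send q m)) \<and>
        inj_on src {s. \<exists>p q m. q \<in> correct n E \<and> event_at E s = (q, Receive p m)} \<and>
        (\<exists>\<Delta>. \<forall>s p q m. q \<in> correct n E \<and> event_at E s = (p, Send q m) \<longrightarrow>
             (\<exists>s'. event_at E s' = (q, Receive p m) \<and> src s' = s \<and>
                   time E s' \<le> time E s + \<Delta>)))"

definition reliable_broadcast ::
    "nat \<Rightarrow> ('acc, 'd, 'sig, 'st, 'tt, 'rt, 'h, 'm) execution \<Rightarrow> bool" where
  "reliable_broadcast n E \<longleftrightarrow>
     \<comment> \<open>at most one delivery per instance and proposer\<close>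
     (\<forall>p\<in>correct n E. \<forall>s s' i k pr pr'.
        event_at E s = (p, Rb_deliver i k pr) \<and> event_at E s' = (p, Rb_deliver i k pr') \<longrightarrow>
        s = s') \<and>
     \<comment> \<open>integrity\<close>
     (\<forall>p\<in>correct n E. \<forall>k\<in>correct n E. \<forall>s i pr.
        event_at E s = (p, Rb_deliver i k pr) \<longrightarrow>
        (\<exists>s'<s. event_at E s' = (k, Rb_broadcast i pr))) \<and>
     \<comment> \<open>agreement\<close>
     (\<forall>p\<in>correct n E. \<forall>q\<in>correct n E. \<forall>s s' i k pr pr'.
        event_at E s = (p, Rb_deliver i k pr) \<and> event_at E s' = (q, Rb_deliver i k pr') \<longrightarrow>
        pr = pr') \<and>
     \<comment> \<open>totality\<close>
     (\<forall>p\<in>correct n E. \<forall>q\<in>correct n E. \<forall>s i k pr.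
        event_at E s = (p, Rb_deliver i k pr) \<longrightarrow>
        (\<exists>s'. event_at E s' = (q, Rb_deliver i k pr))) \<and>
     \<comment> \<open>delivery of the broadcasts of correct nodes\<close>
     (\<forall>k\<in>correct n E. \<forall>q\<in>correct n E. \<forall>s i pr.
        1 \<le> i \<and> event_at E s = (k, Rb_broadcast i pr) \<longrightarrow>
        (\<exists>s'. event_at E s' = (q, Rb_deliver i k pr)))"

definition binary_consensus ::
    "nat \<Rightarrow> ('acc, 'd, 'sig, 'st, 'tt, 'rt, 'h, 'm) execution \<Rightarrow> bool" where
  "binary_consensus n E \<longleftrightarrow>
     \<comment> \<open>at most one decision per instance and proposer\<close>
     (\<forall>p\<in>correct n E. \<forall>s s' i k b b'.
        event_at E s = (p, Bin_decide i k b) \<and> event_at E s' = (p, Bin_decide i k b') \<longrightarrow>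
        s = s') \<and>
     \<comment> \<open>agreement\<close>
     (\<forall>p\<in>correct n E. \<forall>q\<in>correct n E. \<forall>s s' i k b b'.
        event_at E s = (p, Bin_decide i k b) \<and> event_at E s' = (q, Bin_decide i k b') \<longrightarrow>
        b = b') \<and>
     \<comment> \<open>validity\<close>
     (\<forall>p\<in>correct n E. \<forall>s i k b.
        event_at E s = (p, Bin_decide i k b) \<longrightarrow>
        (\<exists>q\<in>correct n E. \<exists>s'<s. event_at E s' = (q, Bin_propose i k b))) \<and>
     \<comment> \<open>termination\<close>
     (\<forall>i\<ge>1. \<forall>k<n.
        (\<forall>q\<in>correct n E. \<exists>s b. event_at E s = (q, Bin_propose i k b)) \<longrightarrow>
        (\<forall>p\<in>correct n E. \<exists>s b. event_at E s = (p, Bin_decide i k b)))"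

text \<open>
  The usual idealisation of signatures against a computationally bounded adversary: signatures
  produced by an account holder pass the verification (verifiability), and a signature that
  reaches a correct node and passes the verification was produced by the account holder
  (unforgeability).
\<close>
definition secure_signatures ::
    "('acc, 'd, 'sig, 'st, 'rc, 'tt, 'rt, 'h, 'm) socchain \<Rightarrow> nat
       \<Rightarrow> ('acc, 'd, 'sig, 'st, 'tt, 'rt, 'h, 'm) execution \<Rightarrow> bool" where
  "secure_signatures P n E \<longleftrightarrow>
     (\<forall>(a, c, g)\<in>produced_sigs E. verify P a c g) \<and>
     (\<forall>p\<in>correct n E. \<forall>s i k pr. event_at E s = (p, Rb_deliver i k pr) \<longrightarrow>
        (\<forall>tx\<in>set (txs pr).
           verify P (issuer tx) (signed_content tx) (signature tx) \<longrightarrow>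
           (issuer tx, signed_content tx, signature tx) \<in> produced_sigs E))"

definition socchain_execution ::
    "('acc, 'd, 'sig, 'st, 'rc, 'tt, 'rt, 'h, 'm) socchain \<Rightarrow> nat \<Rightarrow> nat
       \<Rightarrow> ('acc, 'd, 'sig, 'st, 'tt, 'rt, 'h, 'm) execution \<Rightarrow> bool" where
  "socchain_execution P n t E \<longleftrightarrow>
     byzantine E \<subseteq> {..<n} \<and> card (byzantine E) \<le> t \<and>
     (\<forall>s. fst (event_at E s) < n) \<and>
     progressing_time E \<and>
     partially_synchronous n E \<and>
     secure_signatures P n E \<and>
     reliable_broadcast n E \<and>
     binary_consensus n E \<and>
     correct_nodes_follow_protocol P n E"


section \<open>Valid blocks\<close>

definition correctly_signed ::
    "('acc, 'd, 'sig, 'st, 'rc, 'tt, 'rt, 'h, 'm) socchain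
       \<Rightarrow> ('acc, 'd, 'sig, 'st, 'tt, 'rt, 'h, 'm) execution
       \<Rightarrow> ('acc, 'd, 'sig) transaction \<Rightarrow> bool" where
  "correctly_signed P E tx \<longleftrightarrow>
     verify P (issuer tx) (signed_content tx) (signature tx) \<and>
     (issuer tx, signed_content tx, signature tx) \<in> produced_sigs E"

text \<open>
  Non-conflicting transactions do not conflict with each other, nor with the transactions executed
  before the block, which are given by \<open>before\<close>.  Comparing positions of the list (rather
  than elements) also excludes repetitions, so that the list represents a set.
\<close>
definition valid_transactions ::
    "('acc, 'd, 'sig, 'st, 'rc, 'tt, 'rt, 'h, 'm) socchain
       \<Rightarrow> ('acc, 'd, 'sig, 'st, 'tt, 'rt, 'h, 'm) execution
       \<Rightarrow> ('acc, 'd, 'sig) transaction list \<Rightarrow> ('acc, 'd, 'sig) transaction list \<Rightarrow> bool" where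
  "valid_transactions P E before vs \<longleftrightarrow>
     (\<forall>tx\<in>set vs. well_formed P tx \<and> correctly_signed P E tx) \<and>
     (\<forall>i<length vs. \<forall>j<length vs. i \<noteq> j \<longrightarrow> \<not> conflicting (vs ! i) (vs ! j)) \<and>
     (\<forall>tx\<in>set vs. \<forall>tx'\<in>set before. \<not> conflicting tx tx')"

text \<open>The transactions of the blocks of index \<open>1, \<dots>, l - 1\<close>, i.e. without the genesis block.\<close>
definition transactions_before ::
    "('acc, 'd, 'sig, 'h) block list \<Rightarrow> nat \<Rightarrow> ('acc, 'd, 'sig) transaction list" where
  "transactions_before C l = concat (map (\<lambda>j. val (C ! j)) [1..<l])"

end

theory Submission imports Defs begin

text \<open>
  Every nonce executed by a node lies strictly below the current account nonce of its issuer, while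
  \<open>isvalid\<close> only accepts the current account nonce.  Since account nonces never decrease, no
  transaction executed later can reuse a nonce.  The signatures are genuine because every executed
  transaction comes from a proposal delivered by reliable broadcast.
\<close>

text \<open>An accepted transaction carries the current account nonce of its issuer, and running it
  raises that nonce. The nonces executed for an account thus lie in the half-open interval between
  its account nonces in \<open>s\<close> and \<open>s'\<close>; these two bounds are what later
  allows comparison with earlier and later executions.\<close>

lemma execute_txs_valid:
  assumes nc: "nonces_consumed P" and "execute_txs P s xs = (s', rs, vs)"
  shows "set vs \<subseteq> set xs"
    and "account_nonce P s a \<le> account_nonce P s' a"
    and "tx \<in> set vs \<Longrightarrow> well_formed P tx"
    and "tx \<in> set vs \<Longrightarrow> verify P (issuer tx) (signed_content tx) (signature tx)"
    and "tx \<in> set vs \<Longrightarrow> account_nonce P s (issuer tx) \<le> tx_nonce tx"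
    and "tx \<in> set vs \<Longrightarrow> tx_nonce tx < account_nonce P s' (issuer tx)"
    and "sorted_wrt (\<lambda>x y. \<not> conflicting x y) vs"
proof -
  \<comment> \<open>All claims go through one induction, since the head needs the nonce bounds of
    the tail, for every account and from the updated state.\<close>
  have "set vs \<subseteq> set xs \<and> (\<forall>a. account_nonce P s a \<le> account_nonce P s' a) \<and>
    (\<forall>tx\<in>set vs. well_formed P tx \<and> verify P (issuer tx) (signed_content tx) (signature tx) \<and>
       account_nonce P s (issuer tx) \<le> tx_nonce tx \<and>
       tx_nonce tx < account_nonce P s' (issuer tx)) \<and>
    sorted_wrt (\<lambda>x y. \<not> conflicting x y) vs"
    using assms(2)
  proof (induction xs arbitrary: s rs vs)
    case Nil
    then show ?case by simp
  next
    case (Cons x xs)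
    show ?case
    proof (cases "isvalid P s x")
      case False
      then have "execute_txs P s xs = (s', rs, vs)"
        using Cons.prems by simp
      from Cons.IH[OF this] show ?thesis by auto
    next
      case True
      obtain s1 r where r: "run P s x = (s1, r)" by fastforce
      obtain rs1 vs1 where rec: "execute_txs P s1 xs = (s', rs1, vs1)" and vs: "vs = x # vs1"
        using Cons.prems True r by (auto split: prod.splits)
      have x: "well_formed P x" "verify P (issuer x) (signed_content x) (signature x)"
        "tx_nonce x = account_nonce P s (issuer x)"
        using True by (auto simp: isvalid_def correct_nonce_def)
      have lt: "account_nonce P s (issuer x) < account_nonce P s1 (issuer x)"
        and mono: "account_nonce P s a \<le> account_nonce P s1 a" for a
        using nc True r unfolding nonces_consumed_def by (metis fst_conv)+
      note IH = Cons.IH[OF rec]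
      have mono': "account_nonce P s a \<le> account_nonce P s' a" for a
        using mono[of a] IH by (meson le_trans)
      have "tx_nonce x < account_nonce P s' (issuer x)"
        using x(3) lt IH by (metis order_less_le_trans)
      \<comment> \<open>The tail runs from \<open>s1\<close>, where the account nonce of the issuer
        of \<open>x\<close> already exceeds \<open>tx_nonce x\<close>; the lower bound for the tail
        then excludes a reuse.\<close>
      moreover have "\<not> conflicting x tx" if "tx \<in> set vs1" for tx
        using that IH x(3) lt unfolding conflicting_def by (metis leD)
      moreover have "account_nonce P s (issuer tx) \<le> tx_nonce tx" if "tx \<in> set vs1" for tx
        using that IH mono by (meson le_trans)
      ultimately show ?thesis
        using IH x mono' unfolding vs by auto
    qed
  qed
  then show "set vs \<subseteq> set xs"
    and "account_nonce P s a \<le> account_nonce P s' a"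
    and "tx \<in> set vs \<Longrightarrow> well_formed P tx"
    and "tx \<in> set vs \<Longrightarrow> verify P (issuer tx) (signed_content tx) (signature tx)"
    and "tx \<in> set vs \<Longrightarrow> account_nonce P s (issuer tx) \<le> tx_nonce tx"
    and "tx \<in> set vs \<Longrightarrow> tx_nonce tx < account_nonce P s' (issuer tx)"
    and "sorted_wrt (\<lambda>x y. \<not> conflicting x y) vs"
    by auto
qed

text \<open>The tail drops the genesis block, whose content is unconstrained.\<close>

definition executed_txs ::
    "('acc, 'd, 'sig, 'st, 'tt, 'rt, 'h) node_state \<Rightarrow> ('acc, 'd, 'sig) transaction list" where
  "executed_txs \<sigma> = concat (map val (tl (chain \<sigma>)))"

text \<open>\<open>sorted_wrt\<close> compares positions, so repeated transactions are excluded as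
  well. The strict nonce bound makes the property inductive. \<open>Q\<close> stands for whatever
  delivery guarantees about transactions.\<close>

definition executed_txs_ok ::
    "('acc, 'd, 'sig, 'st, 'rc, 'tt, 'rt, 'h, 'm) socchain
       \<Rightarrow> (('acc, 'd, 'sig) transaction \<Rightarrow> bool)
       \<Rightarrow> ('acc, 'd, 'sig, 'st, 'tt, 'rt, 'h) node_state \<Rightarrow> bool" where
  "executed_txs_ok P Q \<sigma> \<longleftrightarrow>
     chain \<sigma> \<noteq> [] \<and>
     sorted_wrt (\<lambda>x y. \<not> conflicting x y) (executed_txs \<sigma>) \<and>
     (\<forall>tx\<in>set (executed_txs \<sigma>).
        Q tx \<and> well_formed P tx \<and> verify P (issuer tx) (signed_content tx) (signature tx) \<and>
        tx_nonce tx < account_nonce P (state \<sigma>) (issuer tx))"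

text \<open>Between delivery and execution a proposal passes through \<open>props\<close>,
  \<open>superblocks\<close> and \<open>pending\<close>, so \<open>Q\<close> is tracked at all three
  stages.\<close>

definition known_txs_satisfy ::
    "(('acc, 'd, 'sig) transaction \<Rightarrow> bool) \<Rightarrow> ('acc, 'd, 'sig, 'st, 'tt, 'rt, 'h) node_state
       \<Rightarrow> bool" where
  "known_txs_satisfy Q \<sigma> \<longleftrightarrow>
     (\<forall>i k pr. props \<sigma> i k = Some pr \<longrightarrow> (\<forall>tx\<in>set (txs pr). Q tx)) \<and>
     (\<forall>i sb. superblocks \<sigma> i = Some sb \<longrightarrow> (\<forall>pr\<in>set sb. \<forall>tx\<in>set (txs pr). Q tx)) \<and>
     (\<forall>pr\<in>set (pending \<sigma>). \<forall>tx\<in>set (txs pr). Q tx)"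

text \<open>Readiness rules out that \<open>the\<close> is applied to \<open>None\<close> in
  \<open>superblock\<close>, which would yield an arbitrary proposal.\<close>

lemma superblock_from_props:
  assumes "superblock_ready n \<sigma> i" "pr \<in> set (superblock n \<sigma> i)"
  obtains k where "props \<sigma> i k = Some pr"
  using assms unfolding superblock_ready_def superblock_def by auto

text \<open>The account nonce in the old state separates the two groups: earlier transactions of an
  issuer lie strictly below it, those of the new block at or above it.\<close>

lemma execute_proposal_ok:
  assumes nc: "nonces_consumed P" and ok: "executed_txs_ok P Q \<sigma>"
    and Q: "\<forall>tx\<in>set (txs pr). Q tx"
  shows "executed_txs_ok P Q ((execute_proposal P pr \<sigma>)\<lparr>pending := rest\<rparr>)"
proof -
  obtain s' rs vs where ex: "execute_txs P (state \<sigma>) (txs pr) = (s', rs, vs)"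
    using prod_cases3 by blast
  note vs = execute_txs_valid[OF nc ex]
  let ?\<sigma>' = "(execute_proposal P pr \<sigma>)\<lparr>pending := rest\<rparr>"
  have ne: "chain \<sigma> \<noteq> []"
    using ok by (simp add: executed_txs_ok_def)
  \<comment> \<open>Since the chain is nonempty, taking its tail commutes with appending the new
    block.\<close>
  have st: "state ?\<sigma>' = s'" and ne': "chain ?\<sigma>' \<noteq> []"
    and exe: "executed_txs ?\<sigma>' = executed_txs \<sigma> @ vs"
    using ne by (simp_all add: execute_proposal_def ex executed_txs_def Let_def)
  have old: "tx_nonce tx < account_nonce P (state \<sigma>) (issuer tx)"
    if "tx \<in> set (executed_txs \<sigma>)" for tx
    using ok that by (simp add: executed_txs_ok_def)
  have "\<not> conflicting x y" if "x \<in> set (executed_txs \<sigma>)" "y \<in> set vs" for x y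
    using old[OF that(1)] vs(5)[OF that(2)] by (auto simp: conflicting_def)
  moreover have "tx_nonce tx < account_nonce P s' (issuer tx)"
    if "tx \<in> set (executed_txs \<sigma>)" for tx
    using old[OF that] vs(2) by (rule order_less_le_trans)
  ultimately show ?thesis
    using ok vs(1,3,4,6,7) Q ne'
    unfolding executed_txs_ok_def st exe by (auto simp: sorted_wrt_append)
qed

text \<open>Only a delivery brings in new transactions and only an execution changes the chain or
  the state; other events at most move known proposals or update the bitmask.\<close>

lemma node_step_invariant:
  assumes nc: "nonces_consumed P" and step: "node_step P n \<sigma> e \<sigma>'"
    and ok: "executed_txs_ok P Q \<sigma>" and known: "known_txs_satisfy Q \<sigma>"
    and deliver: "\<And>i k pr. e = Rb_deliver i k pr \<Longrightarrow> \<forall>tx\<in>set (txs pr). Q tx"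
  shows "executed_txs_ok P Q \<sigma>' \<and> known_txs_satisfy Q \<sigma>'"
proof (cases e)
  case (Rb_deliver i k pr)
  then show ?thesis
    using step ok known deliver[OF Rb_deliver]
    by (auto simp: executed_txs_ok_def executed_txs_def known_txs_satisfy_def)
next
  case (Decide_superblock i)
  then have ready: "superblock_ready n \<sigma> i"
    and \<sigma>': "\<sigma>' = \<sigma>\<lparr>superblocks := (superblocks \<sigma>)(i := Some (superblock n \<sigma> i))\<rparr>"
    using step by auto
  have "\<forall>tx\<in>set (txs pr). Q tx" if "pr \<in> set (superblock n \<sigma> i)" for pr
    using superblock_from_props[OF ready that] known unfolding known_txs_satisfy_def by metis
  then show ?thesis
    using ok known unfolding \<sigma>'
    by (auto simp: executed_txs_ok_def executed_txs_def known_txs_satisfy_def)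
next
  case Execute_proposal
  then obtain pr rest where pending: "pending \<sigma> = pr # rest"
    and \<sigma>': "\<sigma>' = (execute_proposal P pr \<sigma>)\<lparr>pending := rest\<rparr>"
    using step by auto
  have "\<forall>tx\<in>set (txs pr). Q tx"
    using known pending by (simp add: known_txs_satisfy_def)
  moreover have "known_txs_satisfy Q \<sigma>'"
    using known pending unfolding \<sigma>'
    by (simp add: known_txs_satisfy_def execute_proposal_def Let_def split: prod.split)
  ultimately show ?thesis
    using execute_proposal_ok[OF nc ok] \<sigma>' by blast
qed (use step ok known in
  \<open>auto simp: executed_txs_ok_def executed_txs_def known_txs_satisfy_def\<close>)

lemma init_node_invariant:
  "executed_txs_ok P Q (init_node P)" "known_txs_satisfy Q (init_node P)"
  by (simp_all add: executed_txs_ok_def executed_txs_def known_txs_satisfy_def init_node_def)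

text \<open>Induction over the global steps; events located at other nodes leave the variables of
  \<open>p\<close> unchanged.\<close>

lemma correct_node_invariant:
  assumes nc: "nonces_consumed P" and "correct_nodes_follow_protocol P n E"
    and "p \<in> correct n E"
    and deliver: "\<And>s i k pr. event_at E s = (p, Rb_deliver i k pr) \<Longrightarrow> \<forall>tx\<in>set (txs pr). Q tx"
  shows "executed_txs_ok P Q (node E s p) \<and> known_txs_satisfy Q (node E s p)"
proof (induction s)
  case 0
  then show ?case
    using assms(2,3)
    by (simp add: correct_nodes_follow_protocol_def init_node_invariant)
next
  case (Suc s)
  have step: "if fst (event_at E s) = p
      then node_step P n (node E s p) (snd (event_at E s)) (node E (Suc s) p)
      else node E (Suc s) p = node E s p"
    using assms(2,3) by (simp add: correct_nodes_follow_protocol_def)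
  show ?case
  proof (cases "fst (event_at E s) = p")
    case True
    then show ?thesis
      using node_step_invariant[OF nc, of n "node E s p" "snd (event_at E s)" "node E (Suc s) p"]
        step Suc deliver[of s] by (metis prod.collapse)
  next
    case False
    then show ?thesis using step Suc by simp
  qed
qed

text \<open>Placing block \<open>l\<close> inside the full sequence lets pairwise non-conflict of
  that sequence give it both within the block and against earlier blocks.\<close>

lemma executed_txs_split:
  assumes "1 \<le> l" "l < length (chain \<sigma>)"
  obtains zs where
    "executed_txs \<sigma> = transactions_before (chain \<sigma>) l @ val (chain \<sigma> ! l) @ zs"
proof -
  \<comment> \<open>Removing the genesis block shifts indices: block \<open>l\<close> is at position
    \<open>l - 1\<close> of the tail.\<close>
  have before: "map (\<lambda>j. val (chain \<sigma> ! j)) [1..<l] = map val (take (l - 1) (tl (chain \<sigma>)))"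
    using assms by (auto intro!: nth_equalityI simp: nth_tl)
  have "l - 1 < length (tl (chain \<sigma>))" "tl (chain \<sigma>) ! (l - 1) = chain \<sigma> ! l"
    using assms by (auto simp: nth_tl)
  then have "tl (chain \<sigma>) = take (l - 1) (tl (chain \<sigma>)) @ chain \<sigma> ! l # drop l (tl (chain \<sigma>))"
    using assms(1) id_take_nth_drop[of "l - 1" "tl (chain \<sigma>)"] by simp
  then have "executed_txs \<sigma> =
      transactions_before (chain \<sigma>) l @ val (chain \<sigma> ! l) @ concat (map val (drop l (tl (chain \<sigma>))))"
    unfolding executed_txs_def transactions_before_def before
    by (metis concat.simps(2) concat_append list.simps(9) map_append)
  then show thesis by (rule that)
qed

lemma conflicting_sym: "conflicting x y \<Longrightarrow> conflicting y x"
  by (simp add: conflicting_def)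

theorem theorem4:
  fixes P :: "('acc, 'd, 'sig, 'st, 'rc, 'tt, 'rt, 'h, 'm) socchain"
    and n t :: nat
  assumes "nonces_consumed P"
    and "real t < real n / 3"
  shows "\<forall>E. socchain_execution P n t E \<longrightarrow>
           (\<forall>p\<in>correct n E. \<forall>s. \<forall>l. 1 \<le> l \<and> l < length (chain (node E s p)) \<longrightarrow>
              valid_transactions P E
                (transactions_before (chain (node E s p)) l)
                (val (chain (node E s p) ! l)))"
proof (intro allI impI ballI)
  fix E :: "('acc, 'd, 'sig, 'st, 'tt, 'rt, 'h, 'm) execution" and p s l
  assume E: "socchain_execution P n t E" and p: "p \<in> correct n E"
    and l: "1 \<le> l \<and> l < length (chain (node E s p))"
  let ?\<sigma> = "node E s p"
  let ?before = "transactions_before (chain ?\<sigma>) l" and ?vs = "val (chain ?\<sigma> ! l)"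
  \<comment> \<open>The implication is what unforgeability gives for delivered transactions; its
    premise is supplied by the signature check recorded in \<open>executed_txs_ok\<close>.\<close>
  define Q where "Q tx \<longleftrightarrow> (verify P (issuer tx) (signed_content tx) (signature tx) \<longrightarrow>
    (issuer tx, signed_content tx, signature tx) \<in> produced_sigs E)" for tx
  have "\<forall>tx\<in>set (txs pr). Q tx" if "event_at E s' = (p, Rb_deliver i k pr)" for s' i k pr
    using E p that unfolding socchain_execution_def secure_signatures_def Q_def by blast
  then have ok: "executed_txs_ok P Q ?\<sigma>"
    using correct_node_invariant[OF assms(1) _ p] E unfolding socchain_execution_def by blast
  obtain zs where split: "executed_txs ?\<sigma> = ?before @ ?vs @ zs"
    using executed_txs_split l by blast
  have "sorted_wrt (\<lambda>x y. \<not> conflicting x y) ?vs"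
    and before: "\<forall>x\<in>set ?before. \<forall>y\<in>set ?vs. \<not> conflicting x y"
    and "\<forall>tx\<in>set ?vs. well_formed P tx \<and> correctly_signed P E tx"
    using ok unfolding executed_txs_ok_def split Q_def correctly_signed_def
    by (auto simp: sorted_wrt_append)
  \<comment> \<open>\<open>sorted_wrt\<close> only covers \<open>i < j\<close>; symmetry of
    conflicts handles the other order.\<close>
  moreover from this(1) have "\<not> conflicting (?vs ! i) (?vs ! j)"
    if "i < length ?vs" "j < length ?vs" "i \<noteq> j" for i j
    using that by (metis conflicting_sym nat_neq_iff sorted_wrt_nth_less)
  moreover from before have "\<forall>tx\<in>set ?vs. \<forall>tx'\<in>set ?before. \<not> conflicting tx tx'"
    using conflicting_sym by blast
  ultimately show "valid_transactions P E ?before ?vs"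
    unfolding valid_transactions_def by blast
qed

end
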